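(* For every integer $n \geq 1$, the local queue number of the complete graph $K_n$ on $n$ vertices satisfies $$\operatorname{qn}_\ell(K_n) \leq \left\lceil \Bigl(1-\frac{1}{\sqrt{2}}\Bigr)\, n \right\rceil + 1.$$
   Context: For a fixed total ordering $\prec$ of the vertices of a graph $G$, two independent edges (edges with no common endpoint) $vw$ and $xy$ with $v \prec w$ and $x \prec y$ nest if $v \prec x \prec y \prec w$ or $x \prec v \prec w \prec y$. A queue (with respect to $\prec$) is a set of edges that are pairwise non-nesting. A queue layout of $G$ consists of a vertex ordering $\prec$ and a partition of $E(G)$ into queues; it is $k$-local if each vertex has incident edges in at most $k$ of the queues. The local queue number $\operatorname{qn}_\ell(G)$ is the smallest $k$ such that $G$ has a $k$-local queue layout (the total number of queues is unrestricted). *)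

theory Defs
  imports
    "HOL-Analysis.Analysis"
    "HOL-Library.Disjoint_Sets"
    "Graph_Theory.Graph_Theory"
begin

text \<open>
  In \<^theory>\<open>Graph_Theory.Digraph\<close> a finite simple graph is a symmetric loop-free digraph, in which
  every undirected edge is a pair of opposite arcs. Edges are here two-element vertex sets, so that
  such a pair counts once and cannot be split between two queues.
\<close>

definition edges :: "('a, 'b) pre_digraph \<Rightarrow> 'a set set" where
  "edges G = {{u, v} | u v. u \<rightarrow>\<^bsub>G\<^esub> v}"

text \<open>The relation \<open>r\<close> is the strict vertex ordering: \<open>(u, v) \<in> r\<close> means that \<open>u\<close> precedes \<open>v\<close>.\<close>

definition nest :: "'a rel \<Rightarrow> 'a set \<Rightarrow> 'a set \<Rightarrow> bool" where
  "nest r e f \<longleftrightarrow> e \<inter> f = {} \<and>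
     (\<exists>v w x y. e = {v, w} \<and> f = {x, y} \<and> (v, w) \<in> r \<and> (x, y) \<in> r \<and>
        ((v, x) \<in> r \<and> (x, y) \<in> r \<and> (y, w) \<in> r \<or>
         (x, v) \<in> r \<and> (v, w) \<in> r \<and> (w, y) \<in> r))"

definition queue :: "'a rel \<Rightarrow> 'a set set \<Rightarrow> bool" where
  "queue r Q \<longleftrightarrow> (\<forall>e\<in>Q. \<forall>f\<in>Q. \<not> nest r e f)"

definition queue_layout :: "('a, 'b) pre_digraph \<Rightarrow> 'a rel \<Rightarrow> 'a set set set \<Rightarrow> bool" where
  "queue_layout G r \<Q> \<longleftrightarrow>
     strict_linear_order_on (verts G) r \<and> partition_on (edges G) \<Q> \<and> (\<forall>Q\<in>\<Q>. queue r Q)"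

definition local_layout :: "nat \<Rightarrow> ('a, 'b) pre_digraph \<Rightarrow> 'a set set set \<Rightarrow> bool" where
  "local_layout k G \<Q> \<longleftrightarrow>
     (\<forall>v\<in>verts G. finite {Q\<in>\<Q>. \<exists>e\<in>Q. v \<in> e} \<and> card {Q\<in>\<Q>. \<exists>e\<in>Q. v \<in> e} \<le> k)"

text \<open>
  The \<open>LEAST\<close> ranges over a nonempty set for every finite graph, see
  \<open>ex_local_queue_layout\<close> below.
\<close>

definition local_queue_number :: "('a, 'b) pre_digraph \<Rightarrow> nat" where
  "local_queue_number G = (LEAST k. \<exists>r \<Q>. queue_layout G r \<Q> \<and> local_layout k G \<Q>)"

lemma ex_strict_linear_order_on: "\<exists>r. strict_linear_order_on A r"
proof -
  obtain r :: "'a rel" where "well_order_on UNIV r"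
    using well_order_on by blast
  then have lin: "linear_order_on UNIV r"
    by (simp add: well_order_on_def)
  then have "strict_linear_order_on UNIV (r - Id)"
    by (rule strict_linear_order_on_diff_Id)
  then have "strict_linear_order_on A (r - Id)"
    unfolding strict_linear_order_on_def by (blast intro: total_on_subset)
  then show ?thesis ..
qed

lemma ex_local_queue_layout:
  assumes "fin_digraph G"
  shows "\<exists>k r \<Q>. queue_layout G r \<Q> \<and> local_layout k G \<Q>"
proof -
  interpret fin_digraph G by fact
  obtain r where r: "strict_linear_order_on (verts G) r"
    using ex_strict_linear_order_on by blast
  define \<Q> where "\<Q> = (\<lambda>e. {e}) ` edges G"
  have "edges G = (\<lambda>a. {tail G a, head G a}) ` arcs G"
    by (auto simp: edges_def arcs_ends_conv)
  then have fin: "finite \<Q>"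
    by (simp add: \<Q>_def)
  have "partition_on (edges G) \<Q>"
    by (auto simp: \<Q>_def partition_on_def disjoint_def)
  moreover have "\<not> nest r e e" if "e \<in> edges G" for e
    using that by (auto simp: nest_def edges_def)
  ultimately have "queue_layout G r \<Q>"
    using r by (auto simp: queue_layout_def queue_def \<Q>_def)
  moreover have "local_layout (card \<Q>) G \<Q>"
    using fin by (auto simp: local_layout_def intro!: card_mono)
  ultimately show ?thesis by blast
qed

end

theory Submission
  imports Defs
begin

text \<open>
  Number the vertices \<open>0, \<dots>, n - 1\<close> in the order of the layout and let \<open>m\<close> be
  \<open>(1 - 1 / sqrt 2) n\<close> rounded up. A partition into queues amounts to a labelling of the edges in
  which nested edges get different labels, and the task is to show at most \<open>m + 1\<close> labels to each
  vertex (\<open>local_queue_number_complete_le\<close>).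

  An edge \<open>i < j\<close> of length \<open>j - i \<le> 2 m\<close> belongs to the band and gets the least of \<open>i\<close>,
  \<open>n - 1 - j\<close> and \<open>(2 m - (j - i)) div 2\<close> as its label. All three numbers grow strictly from an
  edge to one nested inside it, so a label class is a queue. Class \<open>k\<close> only uses the vertices from
  \<open>k\<close> to \<open>n - 1 - k\<close>, and \<open>k < m\<close>; hence a vertex at distance \<open>x\<close> from the nearer end of the
  order meets at most \<open>min (x + 1) m\<close> of these queues and may still meet \<open>max 1 (m - x)\<close> others.

  The longer edges form the corner. In the coordinates \<open>x = i\<close> and \<open>y = n - 1 - j\<close> they fill a
  triangle \<open>x + y < n - 1 - 2 m\<close>, two of them nest exactly if both coordinates increase, and since
  \<open>n \<le> 4 m\<close> no vertex is the left end of one long edge and the right end of another. For each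
  \<open>c\<close> the hook \<open>max x y = c\<close> is a queue. If all corner edges were put into hooks, vertex \<open>x\<close>
  would meet its own hook and one hook for every neighbour \<open>y > x\<close>. With \<open>e = n - 3 m - 1\<close>, or
  \<open>e = 0\<close> if that is negative, this is \<open>e - x\<close> queues too many for \<open>x < e\<close>, whereas a vertex \<open>c\<close> with \<open>e \<le> c < m\<close> has room for
  \<open>min (c - e) (m - 1 - c)\<close> further queues. Moving the edge between \<open>c\<close> and \<open>x\<close> from hook \<open>c\<close>
  into a star at \<open>x\<close> transfers one unit of load from \<open>x\<close> to \<open>c\<close>, and the edges with
  \<open>x, y < e\<close> are divided evenly among the stars at their ends. On each side the stars then require
  about \<open>e\<^sup>2 / 2 + e\<close> transfers and the free room is about \<open>(m - e)\<^sup>2 / 4 - (m - e) / 2\<close>. This is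
  enough because \<open>n - 2 m \<le> sqrt 2 * m\<close>, that is, \<open>m + e + 1 \<le> sqrt 2 * m\<close>: this is where
  the constant \<open>1 - 1 / sqrt 2\<close> comes from (\<open>ex_flip_sets\<close>). The transfers are spread evenly over
  the vertices \<open>x < e\<close> by always serving those with the largest remaining demand
  (\<open>ex_cover_demand\<close>).
\<close>

section \<open>Layouts of complete graphs from edge labels\<close>

text \<open>
  The queues are the fibres of the labelling, transported to \<open>G\<close> along an arbitrary numbering of its
  vertices. The number of fibres that contain an edge at \<open>v\<close> is the number of labels seen at \<open>v\<close>.
\<close>

lemma local_queue_number_complete_le:
  fixes G :: "('a, 'b) pre_digraph" and lab :: "nat \<Rightarrow> nat \<Rightarrow> 'l"
  assumes G: "complete_digraph n G"
    and nesting: "\<And>i x y j. i < x \<Longrightarrow> x < y \<Longrightarrow> y < j \<Longrightarrow> j < n \<Longrightarrow> lab i j \<noteq> lab x y"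
    and load: "\<And>v. v < n \<Longrightarrow> card (lab v ` {v<..<n} \<union> (\<lambda>i. lab i v) ` {..<v}) \<le> k"
  shows "local_queue_number G \<le> k"
proof -
  have "graph G" using G by (simp add: complete_digraph_def)
  then interpret graph G .
  have card_n: "card (verts G) = n"
    and adj: "arcs_ends G = {(u, v). (u, v) \<in> verts G \<times> verts G \<and> u \<noteq> v}"
    using G by (auto simp: complete_digraph_def)
  obtain p where p: "bij_betw p (verts G) {..<n}"
    using ex_bij_betw_finite_nat[OF finite_verts] card_n by (auto simp: atLeast0LessThan)
  have p_inj: "u = v" if "u \<in> verts G" "v \<in> verts G" "p u = p v" for u v
    using p that by (auto simp: bij_betw_def inj_on_def)
  have p_less: "p u < n" if "u \<in> verts G" for u
    using p that by (auto simp: bij_betw_def)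
  define r where "r = {(u, v). u \<in> verts G \<and> v \<in> verts G \<and> p u < p v}"
  define c where "c = (\<lambda>e. lab (Min (p ` e)) (Max (p ` e)))"
  define fib where "fib = (\<lambda>l. {e \<in> edges G. c e = l})"
  define \<Q> where "\<Q> = fib ` c ` edges G"
  have c_pair: "c {u, v} = lab (p u) (p v)" if "p u < p v" for u v
    using that by (simp add: c_def)
  have edges_iff: "e \<in> edges G \<longleftrightarrow> (\<exists>u v. e = {u, v} \<and> (u, v) \<in> r)" for e
  proof
    assume "e \<in> edges G"
    then obtain u v where uv: "e = {u, v}" "u \<in> verts G" "v \<in> verts G" "u \<noteq> v"
      by (auto simp: edges_def adj)
    then have "p u < p v \<or> p v < p u" using p_inj by (meson linorder_neqE_nat)
    with uv show "\<exists>u v. e = {u, v} \<and> (u, v) \<in> r"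
      by (auto simp: r_def insert_commute)
  qed (auto simp: r_def edges_def adj)
  have "strict_linear_order_on (verts G) r"
    using p_inj by (fastforce simp: strict_linear_order_on_def r_def trans_def irrefl_def total_on_def
        dest: linorder_neqE_nat)
  moreover have "partition_on (edges G) \<Q>"
    by (auto simp: partition_on_def \<Q>_def fib_def disjoint_def)
  moreover have "queue r Q" if "Q \<in> \<Q>" for Q
  proof -
    have "c e = c f" if "e \<in> Q" "f \<in> Q" for e f
      using that \<open>Q \<in> \<Q>\<close> by (auto simp: \<Q>_def fib_def)
    moreover have "c e \<noteq> c f" if "nest r e f" for e f
    proof -
      obtain v w x y where vw: "e = {v, w}" "f = {x, y}" "(v, w) \<in> r" "(x, y) \<in> r"
        "(v, x) \<in> r \<and> (x, y) \<in> r \<and> (y, w) \<in> r \<or> (x, v) \<in> r \<and> (v, w) \<in> r \<and> (w, y) \<in> r"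
        using \<open>nest r e f\<close> unfolding nest_def by blast
      then have "c e = lab (p v) (p w)" "c f = lab (p x) (p y)"
        by (auto simp: r_def c_pair)
      with vw nesting[of "p v" "p x" "p y" "p w"] nesting[of "p x" "p v" "p w" "p y"] p_less
      show ?thesis by (auto simp: r_def)
    qed
    ultimately show ?thesis unfolding queue_def by blast
  qed
  ultimately have layout: "queue_layout G r \<Q>"
    by (simp add: queue_layout_def)
  have "local_layout k G \<Q>"
    unfolding local_layout_def
  proof
    fix v assume v: "v \<in> verts G"
    let ?L = "lab (p v) ` {p v<..<n} \<union> (\<lambda>i. lab i (p v)) ` {..<p v}"
    have sub: "{Q \<in> \<Q>. \<exists>e\<in>Q. v \<in> e} \<subseteq> fib ` ?L"
    proof
      fix Q assume "Q \<in> {Q \<in> \<Q>. \<exists>e\<in>Q. v \<in> e}"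
      then obtain e where e: "e \<in> edges G" "Q = fib (c e)" "v \<in> e"
        by (auto simp: \<Q>_def fib_def)
      then obtain u w where uw: "e = {u, w}" "(u, w) \<in> r" by (auto simp: edges_iff)
      then have "c e = lab (p u) (p w)" "p u < p w" "p w < n"
        using p_less by (auto simp: r_def c_pair)
      moreover have "v = u \<or> v = w" using e uw by auto
      ultimately have "c e \<in> ?L" by auto
      with e show "Q \<in> fib ` ?L" by blast
    qed
    have fin: "finite ?L" by simp
    have "card {Q \<in> \<Q>. \<exists>e\<in>Q. v \<in> e} \<le> card (fib ` ?L)"
      using sub fin by (intro card_mono) auto
    also have "\<dots> \<le> card ?L" using fin by (rule card_image_le)
    also have "\<dots> \<le> k" using load p_less v by blast
    finally show "finite {Q \<in> \<Q>. \<exists>e\<in>Q. v \<in> e} \<and> card {Q \<in> \<Q>. \<exists>e\<in>Q. v \<in> e} \<le> k"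
      using finite_subset[OF sub finite_imageI[OF fin]] by simp
  qed
  with layout show ?thesis
    unfolding local_queue_number_def by (blast intro: Least_le)
qed

section \<open>Levelling a function with decrements of prescribed sizes\<close>

text \<open>
  Decrementing the points with the larger value first keeps all values within one unit of each other.
\<close>

lemma ex_level_step:
  fixes w :: "'a \<Rightarrow> int"
  assumes fin: "finite Y" and w: "\<forall>y\<in>Y. w y \<in> {q, q + 1}" and r: "r \<le> card Y"
  shows "\<exists>S\<subseteq>Y. card S = r \<and> (\<exists>q'. \<forall>y\<in>Y. w y - of_bool (y \<in> S) \<in> {q', q' + 1})"
proof -
  let ?top = "{y \<in> Y. w y = q + 1}"
  show ?thesis
  proof (cases "r \<le> card ?top")
    case True
    then obtain S where "S \<subseteq> ?top" "card S = r"
      by (meson obtain_subset_with_card_n)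
    then show ?thesis using w by (intro exI[of _ S] conjI exI[of _ q]) auto
  next
    case False
    then obtain S where "?top \<subseteq> S" "S \<subseteq> Y" "card S = r"
      using exists_subset_between[of ?top r Y] r fin by auto
    then show ?thesis using w by (intro exI[of _ S] conjI exI[of _ "q - 1"]) auto
  qed
qed

lemma ex_level:
  fixes w :: "'a \<Rightarrow> int" and g :: nat
  assumes fin: "finite Y" and w: "\<forall>y\<in>Y. w y \<in> {q, q + 1}" and r: "\<forall>a<g. r a \<le> card Y"
  shows "\<exists>S. (\<forall>a<g. S a \<subseteq> Y \<and> card (S a) = r a) \<and>
    (\<exists>q'. \<forall>y\<in>Y. w y - int (card {a. a < g \<and> y \<in> S a}) \<in> {q', q' + 1})"
  using r
proof (induction g)
  case 0
  then show ?case using w by auto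
next
  case (Suc g)
  have "\<forall>a<g. r a \<le> card Y" using Suc.prems by simp
  then obtain S q' where S: "\<forall>a<g. S a \<subseteq> Y \<and> card (S a) = r a"
    and q': "\<forall>y\<in>Y. w y - int (card {a. a < g \<and> y \<in> S a}) \<in> {q', q' + 1}"
    using Suc.IH by blast
  obtain T q'' where T: "T \<subseteq> Y" "card T = r g"
    and q'': "\<forall>y\<in>Y. w y - int (card {a. a < g \<and> y \<in> S a}) - of_bool (y \<in> T) \<in> {q'', q'' + 1}"
    using ex_level_step[OF fin q', of "r g"] Suc.prems by blast
  let ?S = "S(g := T)"
  have "card {a. a < Suc g \<and> y \<in> ?S a} = card {a. a < g \<and> y \<in> S a} + of_bool (y \<in> T)" for y
  proof -
    have "{a. a < Suc g \<and> y \<in> ?S a} = {a. a < g \<and> y \<in> S a} \<union> (if y \<in> T then {g} else {})"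
      by (auto simp: less_Suc_eq)
    then show ?thesis by auto
  qed
  then have "\<forall>y\<in>Y. w y - int (card {a. a < Suc g \<and> y \<in> ?S a}) \<in> {q'', q'' + 1}"
    using q'' by (simp add: algebra_simps)
  moreover have "\<forall>a<Suc g. ?S a \<subseteq> Y \<and> card (?S a) = r a"
    using S T by (auto simp: less_Suc_eq)
  ultimately show ?case by blast
qed

lemma sum_card_incidences:
  fixes S :: "nat \<Rightarrow> 'a set"
  assumes "finite Y" "\<forall>a<g. S a \<subseteq> Y"
  shows "(\<Sum>y\<in>Y. card {a. a < g \<and> y \<in> S a}) = (\<Sum>a<g. card (S a))"
proof -
  have "(\<Sum>y\<in>Y. card {a. a < g \<and> y \<in> S a}) = (\<Sum>y\<in>Y. \<Sum>a | a \<in> {..<g} \<and> y \<in> S a. 1)"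
    by simp
  also have "\<dots> = (\<Sum>a<g. \<Sum>y | y \<in> Y \<and> y \<in> S a. 1)"
    using assms(1) by (rule sum.swap_restrict) simp
  also have "\<dots> = (\<Sum>a<g. card (S a))"
    using assms(2) by (intro sum.cong) (auto intro!: arg_cong[where f = card])
  finally show ?thesis .
qed

text \<open>
  After levelling, the remaining demands differ by at most one. If one of them were still positive,
  none would be negative, so their sum would be positive; but the sum is at most \<open>0\<close> by the
  hypothesis \<open>total\<close>.
\<close>

lemma ex_cover_demand:
  fixes w :: "'a \<Rightarrow> int" and g :: nat
  assumes fin: "finite Y" and w: "\<forall>y\<in>Y. w y \<in> {q, q + 1}" and r: "\<forall>a<g. r a \<le> card Y"
    and total: "sum w Y \<le> (\<Sum>a<g. int (r a))"
  shows "\<exists>S. (\<forall>a<g. S a \<subseteq> Y \<and> card (S a) = r a) \<and>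
    (\<forall>y\<in>Y. w y \<le> int (card {a. a < g \<and> y \<in> S a}))"
proof -
  obtain S q' where S: "\<forall>a<g. S a \<subseteq> Y \<and> card (S a) = r a"
    and q': "\<forall>y\<in>Y. w y - int (card {a. a < g \<and> y \<in> S a}) \<in> {q', q' + 1}"
    using ex_level[OF fin w r] by blast
  let ?d = "\<lambda>y. w y - int (card {a. a < g \<and> y \<in> S a})"
  have "(\<Sum>y\<in>Y. int (card {a. a < g \<and> y \<in> S a})) = (\<Sum>a<g. int (r a))"
    using sum_card_incidences[of Y g S] S fin by (simp flip: of_nat_sum)
  then have le: "sum ?d Y \<le> 0"
    using total by (simp add: sum_subtractf)
  have "?d y \<le> 0" if y: "y \<in> Y" for y
  proof (rule ccontr)
    assume pos: "\<not> ?d y \<le> 0"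
    have "q' \<ge> 0" using q' y pos by force
    then have "\<forall>z\<in>Y. ?d z \<ge> 0" using q' by force
    then have "sum ?d Y > 0"
      using fin y pos by (intro sum_pos2[of Y y ?d]) auto
    with le show False by simp
  qed
  then show ?thesis using S by (intro exI[of _ S]) auto
qed

section \<open>The corner of far-apart vertices\<close>

text \<open>
  Extending the range of the tent \<open>min a (g - 1 - a)\<close> by one point at each end raises it by \<open>1\<close> at
  each of the \<open>g\<close> old points and adds nothing else. This is why the induction goes in steps of two.
\<close>

lemma tent_sum_bound: "int g * int g - 2 * int g \<le> 4 * (\<Sum>a<g. int (min a (g - 1 - a)))"
proof (induction g rule: nat_induct2)
  case (step g)
  have "(\<Sum>a<g + 2. int (min a (g + 2 - 1 - a))) = (\<Sum>a<Suc (Suc g). int (min a (Suc g - a)))"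
    by simp
  also have "\<dots> = (\<Sum>a<Suc g. int (min (Suc a) (g - a)))"
    by (subst sum.lessThan_Suc_shift) simp
  also have "\<dots> = (\<Sum>a<g. int (min (Suc a) (g - a)))"
    by simp
  also have "\<dots> = (\<Sum>a<g. int (min a (g - 1 - a)) + 1)"
    by (intro sum.cong) auto
  also have "\<dots> = (\<Sum>a<g. int (min a (g - 1 - a))) + int g"
    by (simp add: sum.distrib)
  finally show ?case using step by (simp add: algebra_simps)
qed auto

text \<open>
  A pair \<open>(x, y) \<in> S\<close> will be put into a star centred at its row \<open>x\<close>, where it adds to the load of
  the column \<open>y\<close>; a pair outside \<open>S\<close> adds to the load of its row. The loads are balanced on both
  sides, and the two sides share the pairs equally, up to one pair if \<open>e\<close> is odd.
\<close>

lemma ex_balanced_bipartite_orientation: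
  "\<exists>S :: (nat \<times> nat) set.
    (\<exists>q. \<forall>x\<in>{..<e}. int (card {y. y < e \<and> (x, y) \<notin> S}) \<in> {q, q + 1}) \<and>
    (\<exists>q. \<forall>y\<in>{..<e}. int (card {x. x < e \<and> (x, y) \<in> S}) \<in> {q, q + 1}) \<and>
    2 * (\<Sum>x<e. int (card {y. y < e \<and> (x, y) \<notin> S})) \<le> int (e * e) + 1 \<and>
    2 * (\<Sum>y<e. int (card {x. x < e \<and> (x, y) \<in> S})) \<le> int (e * e) + 1"
proof -
  \<comment> \<open>Row \<open>x\<close> selects \<open>r x\<close> columns. The differences telescope to half of all pairs, and each of them
    is \<open>e / 2\<close> rounded up or down; the columns are balanced by levelling.\<close>
  define r where "r x = (Suc x * e) div 2 - (x * e) div 2" for x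
  have r_int: "int (r x) = int (Suc x * e) div 2 - int (x * e) div 2" for x
  proof -
    have "(x * e) div 2 \<le> (Suc x * e) div 2" by (intro div_le_mono) simp
    then show ?thesis unfolding r_def by (simp add: of_nat_diff zdiv_int)
  qed
  have r_mid: "r x = e div 2 \<or> r x = e - e div 2" for x
  proof -
    have "(e + t) div 2 - t div 2 = e div 2 \<or> (e + t) div 2 - t div 2 = e - e div 2" for t
      by (cases "even e"; cases "even t") (auto elim!: evenE oddE)
    then show ?thesis unfolding r_def mult_Suc .
  qed
  have r_sum: "(\<Sum>x<k. int (r x)) = int (k * e) div 2" for k
  proof (induction k)
    case (Suc k)
    then show ?case by (simp add: r_int)
  qed simp
  have r_le: "r x \<le> e" for x using r_mid[of x] by auto
  then have "\<forall>x<e. r x \<le> card {..<e}" by simp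
  then obtain R q where R: "\<forall>x<e. R x \<subseteq> {..<e} \<and> card (R x) = r x"
    and q: "\<forall>y\<in>{..<e}. 0 - int (card {x. x < e \<and> y \<in> R x}) \<in> {q, q + 1}"
    using ex_level[of "{..<e}" "\<lambda>_. 0" 0 e r] by auto
  define S where "S = {(x, y). y \<in> R x}"
  have row: "int (card {y. y < e \<and> (x, y) \<notin> S}) = int e - int (r x)" if "x < e" for x
  proof -
    have "{y. y < e \<and> (x, y) \<notin> S} = {..<e} - R x" by (auto simp: S_def)
    moreover have "card ({..<e} - R x) = e - r x"
      using R that by (subst card_Diff_subset) (auto intro: finite_subset)
    ultimately show ?thesis using r_le[of x] by simp
  qed
  have col: "{x. x < e \<and> (x, y) \<in> S} = {x. x < e \<and> y \<in> R x}" for y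
    by (simp add: S_def)
  have "\<forall>x\<in>{..<e}. int (card {y. y < e \<and> (x, y) \<notin> S}) \<in> {int (e div 2), int (e div 2) + 1}"
  proof
    fix x assume "x \<in> {..<e}"
    then show "int (card {y. y < e \<and> (x, y) \<notin> S}) \<in> {int (e div 2), int (e div 2) + 1}"
      using row[of x] r_mid[of x] by simp presburger
  qed
  moreover have "\<forall>y\<in>{..<e}. int (card {x. x < e \<and> (x, y) \<in> S}) \<in> {- q - 1, (- q - 1) + 1}"
    using q unfolding col by force
  moreover have "(\<Sum>x<e. int (card {y. y < e \<and> (x, y) \<notin> S})) = int (e * e) - int (e * e) div 2"
    using r_sum[of e] by (simp add: row sum_subtractf)
  moreover have "(\<Sum>y<e. int (card {x. x < e \<and> (x, y) \<in> S})) = int (e * e) div 2"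
    using sum_card_incidences[of "{..<e}" e R] R r_sum[of e] unfolding col
    by (simp flip: of_nat_sum)
  ultimately show ?thesis
    by (intro exI[of _ S] conjI; (blast | linarith))
qed

text \<open>
  Here \<open>w x\<close> is the load that \<open>x\<close> receives inside the square \<open>x, y < e\<close>. The edge between \<open>x\<close>
  and \<open>c\<close> leaves hook \<open>c\<close> for the star at \<open>x\<close> if \<open>x \<in> P c\<close>. Vertex \<open>x\<close> needs \<open>w x + 1\<close> such
  edges, the additional one paying for the star at \<open>x\<close> itself.
\<close>

lemma ex_flip_sets:
  fixes w :: "nat \<Rightarrow> int"
  assumes sq: "(m + e + 1)\<^sup>2 \<le> 2 * m\<^sup>2" and e: "e > 0"
    and w: "\<forall>x\<in>{..<e}. w x \<in> {q, q + 1}" and total: "2 * (\<Sum>x<e. w x) \<le> int (e * e) + 1"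
  shows "\<exists>P. (\<forall>c. P c \<subseteq> {..<e} \<and> card (P c) \<le> min (c - e) (m - 1 - c)) \<and>
    (\<forall>x<e. w x + 1 \<le> int (card {c \<in> {e..<m}. x \<in> P c}))"
proof -
  have "e < m"
  proof (rule ccontr)
    assume "\<not> e < m"
    then have "(m + m)\<^sup>2 < (m + e + 1)\<^sup>2" by (intro power_strict_mono) auto
    moreover have "(m + m)\<^sup>2 = 4 * m\<^sup>2" by (simp flip: mult_2 add: power_mult_distrib)
    ultimately show False using sq by linarith
  qed
  define f where "f = m - e"
  have f: "m = e + f" "f > 0" using \<open>e < m\<close> by (simp_all add: f_def)
  \<comment> \<open>At most \<open>e\<close> edges can be moved per vertex \<open>c\<close>, so the tent of capacities must not be higher
    than \<open>e\<close>. Cutting its base to \<open>2 * e + 2\<close> ensures this and leaves enough room.\<close>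
  define g where "g = min f (2 * e + 2)"
  have "2 * int e * int e + 4 * int e + 1 \<le> int g * int g - 2 * int g"
  proof (cases "f \<le> 2 * e + 2")
    case True
    have "int ((m + e + 1)\<^sup>2) \<le> int (2 * m\<^sup>2)"
      using sq by (rule of_nat_mono)
    then have "(2 * int e + int f + 1)\<^sup>2 \<le> 2 * (int e + int f)\<^sup>2"
      by (simp add: f(1) add_ac)
    then show ?thesis
      using True by (simp add: g_def power2_eq_square algebra_simps)
  next
    case False
    have "1 \<le> int e * int e" using e mult_mono[of 1 "int e" 1 "int e"] by simp
    with False show ?thesis by (simp add: g_def algebra_simps)
  qed
  then have cap: "2 * int e * int e + 4 * int e + 1 \<le> 4 * (\<Sum>a<g. int (min a (g - 1 - a)))"
    using tent_sum_bound[of g] by linarith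
  have sum1: "(\<Sum>x\<in>{..<e}. w x + 1) \<le> (\<Sum>a<g. int (min a (g - 1 - a)))"
  proof -
    have "4 * (\<Sum>x\<in>{..<e}. w x + 1) \<le> 2 * int e * int e + 2 + 4 * int e"
      using total by (simp add: sum.distrib)
    then show ?thesis using cap by presburger
  qed
  have "\<forall>a<g. min a (g - 1 - a) \<le> card {..<e}" by (auto simp: g_def)
  moreover have "\<forall>x\<in>{..<e}. w x + 1 \<in> {q + 1, (q + 1) + 1}" using w by auto
  ultimately obtain S where S: "\<forall>a<g. S a \<subseteq> {..<e} \<and> card (S a) = min a (g - 1 - a)"
    and dem: "\<forall>x\<in>{..<e}. w x + 1 \<le> int (card {a. a < g \<and> x \<in> S a})"
    using ex_cover_demand[OF _ _ _ sum1, of "q + 1"] by auto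
  define P where "P c = (if e \<le> c \<and> c < e + g then S (c - e) else {})" for c
  have g_le: "e + g \<le> m" using f by (simp add: g_def)
  have "P c \<subseteq> {..<e} \<and> card (P c) \<le> min (c - e) (m - 1 - c)" for c
  proof (cases "e \<le> c \<and> c < e + g")
    case True
    then have "c - e < g" by auto
    with S True g_le show ?thesis by (auto simp: P_def)
  qed (auto simp: P_def)
  moreover have "w x + 1 \<le> int (card {c \<in> {e..<m}. x \<in> P c})" if x: "x < e" for x
  proof -
    have "card {a. a < g \<and> x \<in> S a} = card ((+) e ` {a. a < g \<and> x \<in> S a})"
      by (simp add: card_image)
    also have "\<dots> \<le> card {c \<in> {e..<m}. x \<in> P c}"
      using g_le by (intro card_mono) (auto simp: P_def)
    finally have "int (card {a. a < g \<and> x \<in> S a}) \<le> int (card {c \<in> {e..<m}. x \<in> P c})"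
      by (rule of_nat_mono)
    moreover have "w x + 1 \<le> int (card {a. a < g \<and> x \<in> S a})" using dem x by blast
    ultimately show ?thesis by (rule order_trans[rotated])
  qed
  ultimately show ?thesis by blast
qed

text \<open>
  \<open>Row x\<close> and \<open>Col y\<close> are the stars at the vertices numbered \<open>x\<close> and \<open>n - 1 - y\<close>.
\<close>

datatype label = Band nat | Hook nat | Row nat | Col nat

text \<open>
  The edges that are moved from hooks to stars are those with \<open>x \<in> P y\<close>, where \<open>x < e \<le> y\<close>, and
  those with \<open>y \<in> Q x\<close>, where \<open>y < e \<le> x\<close>.
\<close>

definition corner :: "nat \<Rightarrow> (nat \<times> nat) set \<Rightarrow> (nat \<Rightarrow> nat set) \<Rightarrow> (nat \<Rightarrow> nat set) \<Rightarrow> nat \<Rightarrow> nat \<Rightarrow> label"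
  where
  "corner e S P Q x y =
    (if x < e \<and> y < e then if (x, y) \<in> S then Row x else Col y
     else if x \<in> P y then Row x
     else if y \<in> Q x then Col y
     else Hook (max x y))"

lemma corner_nesting:
  "x < x' \<Longrightarrow> y < y' \<Longrightarrow> corner e S P Q x y \<noteq> corner e S P Q x' y'"
  by (auto simp: corner_def split: if_splits)

text \<open>
  The capacity \<open>min (c - e) (m - 1 - c)\<close> is the number of queues that vertex \<open>c\<close> can take in addition
  to the hooks: it meets \<open>1 + (m + e - 1 - 2 c)\<close> hooks, or just its own if the bracket is
  negative, and may meet \<open>m - c\<close> queues. Truncated subtraction makes it \<open>0\<close> outside
  \<open>e \<le> c < m\<close>.
\<close>

definition flip_system ::
  "nat \<Rightarrow> nat \<Rightarrow> (nat \<times> nat) set \<Rightarrow> (nat \<Rightarrow> nat set) \<Rightarrow> (nat \<Rightarrow> nat set) \<Rightarrow> bool" where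
  "flip_system m e S P Q \<longleftrightarrow>
    (\<forall>c. P c \<subseteq> {..<e} \<and> card (P c) \<le> min (c - e) (m - 1 - c)) \<and>
    (\<forall>c. Q c \<subseteq> {..<e} \<and> card (Q c) \<le> min (c - e) (m - 1 - c)) \<and>
    (\<forall>x<e. card {y. y < e \<and> (x, y) \<notin> S} + 1 \<le> card {c \<in> {e..<m}. x \<in> P c}) \<and>
    (\<forall>y<e. card {x. x < e \<and> (x, y) \<in> S} + 1 \<le> card {c \<in> {e..<m}. y \<in> Q c})"

lemma flip_system_outside:
  assumes F: "flip_system m e S P Q" and c: "c < e \<or> m \<le> c"
  shows "P c = {}" "Q c = {}"
proof -
  have "P c \<subseteq> {..<e}" "Q c \<subseteq> {..<e}" "card (P c) \<le> min (c - e) (m - 1 - c)"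
    "card (Q c) \<le> min (c - e) (m - 1 - c)"
    using F by (simp_all add: flip_system_def)
  with c show "P c = {}" "Q c = {}"
    by (auto simp: finite_subset[of _ "{..<e}"])
qed

lemma ex_flip_system:
  assumes sq: "e > 0 \<Longrightarrow> (m + e + 1)\<^sup>2 \<le> 2 * m\<^sup>2"
  shows "\<exists>S P Q. flip_system m e S P Q"
proof (cases "e = 0")
  case True
  then have "flip_system m e {} (\<lambda>_. {}) (\<lambda>_. {})" by (simp add: flip_system_def)
  then show ?thesis by blast
next
  case False
  obtain S :: "(nat \<times> nat) set" and q1 q2 where S:
    "\<forall>x\<in>{..<e}. int (card {y. y < e \<and> (x, y) \<notin> S}) \<in> {q1, q1 + 1}"
    "\<forall>y\<in>{..<e}. int (card {x. x < e \<and> (x, y) \<in> S}) \<in> {q2, q2 + 1}"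
    "2 * (\<Sum>x<e. int (card {y. y < e \<and> (x, y) \<notin> S})) \<le> int (e * e) + 1"
    "2 * (\<Sum>y<e. int (card {x. x < e \<and> (x, y) \<in> S})) \<le> int (e * e) + 1"
    using ex_balanced_bipartite_orientation[of e] by blast
  from False have e: "e > 0" by simp
  obtain P where "\<forall>c. P c \<subseteq> {..<e} \<and> card (P c) \<le> min (c - e) (m - 1 - c)"
    "\<forall>x<e. int (card {y. y < e \<and> (x, y) \<notin> S}) + 1 \<le> int (card {c \<in> {e..<m}. x \<in> P c})"
    using ex_flip_sets[OF sq[OF e] e S(1) S(3)] by blast
  moreover obtain Q where "\<forall>c. Q c \<subseteq> {..<e} \<and> card (Q c) \<le> min (c - e) (m - 1 - c)"
    "\<forall>y<e. int (card {x. x < e \<and> (x, y) \<in> S}) + 1 \<le> int (card {c \<in> {e..<m}. y \<in> Q c})"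
    using ex_flip_sets[OF sq[OF e] e S(2) S(4)] by blast
  ultimately have "flip_system m e S P Q" unfolding flip_system_def by (auto simp: Suc_le_eq)
  then show ?thesis by blast
qed

text \<open>
  A vertex \<open>x \<ge> m\<close> only has neighbours \<open>y < e\<close> and sees no queue but its hook. A vertex with
  \<open>e \<le> x < m\<close> sees its own hook, those of its larger neighbours, and the stars that took edges
  from its hook. A vertex \<open>x < e\<close> sees its own star, stars of columns \<open>y < e\<close>, and the hooks that kept
  their edge at \<open>x\<close>.
\<close>

lemma card_corner_row:
  assumes F: "flip_system m e S P Q" and "e \<le> m"
  shows "card (corner e S P Q x ` {y. x + y < m + e}) \<le> max 1 (m - x)"
proof -
  let ?L = "corner e S P Q x ` {y. x + y < m + e}"
  have PQ: "P c \<subseteq> {..<e}" "card (P c) \<le> min (c - e) (m - 1 - c)"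
    "Q c \<subseteq> {..<e}" "card (Q c) \<le> min (c - e) (m - 1 - c)" for c
    using F by (simp_all add: flip_system_def)
  have fin: "finite (P c)" "finite (Q c)" for c
    using finite_subset[OF PQ(1)] finite_subset[OF PQ(3)] by simp_all
  note out = flip_system_outside[OF F]
  consider "m \<le> x" | "e \<le> x" "x < m" | "x < e" by linarith
  then show ?thesis
  proof cases
    case 1
    have "?L \<subseteq> {Hook x}"
      using 1 \<open>e \<le> m\<close> out(2)[of x] PQ(1) by (force simp: corner_def)
    then have "card ?L \<le> card {Hook x}" by (intro card_mono) auto
    then show ?thesis by simp
  next
    case 2
    have "?L \<subseteq> {Hook x} \<union> Hook ` {x<..<m + e - x} \<union> Col ` Q x"
    proof (rule image_subsetI)
      fix y assume "y \<in> {y. x + y < m + e}"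
      moreover have "x \<notin> P y" using 2 PQ(1)[of y] by auto
      ultimately show "corner e S P Q x y \<in> {Hook x} \<union> Hook ` {x<..<m + e - x} \<union> Col ` Q x"
        using 2 by (cases "y \<in> Q x"; cases "y \<le> x") (auto simp: corner_def)
    qed
    then have "card ?L \<le> card ({Hook x} \<union> Hook ` {x<..<m + e - x} \<union> Col ` Q x)"
      using fin by (intro card_mono) auto
    also have "\<dots> \<le> card {Hook x} + card (Hook ` {x<..<m + e - x}) + card (Col ` Q x)"
      by (rule order_trans[OF card_Un_le add_right_mono[OF card_Un_le]])
    also have "\<dots> \<le> 1 + (m + e - x - Suc x) + card (Q x)"
      using card_image_le[OF fin(2), of Col x] card_image_le[of "{x<..<m + e - x}" Hook] by simp
    also have "\<dots> \<le> m - x" using PQ(4)[of x] 2 by arith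
    finally show ?thesis by simp
  next
    case 3
    let ?E = "{y. y < e \<and> (x, y) \<notin> S}" and ?N = "{c \<in> {e..<m}. x \<in> P c}"
    let ?U = "({e..<m} - ?N) \<union> {m..<m + e - x}"
    have "?L \<subseteq> {Row x} \<union> Col ` ?E \<union> Hook ` ?U"
    proof (rule image_subsetI)
      fix y assume "y \<in> {y. x + y < m + e}"
      then have y: "y < m + e - x" by auto
      show "corner e S P Q x y \<in> {Row x} \<union> Col ` ?E \<union> Hook ` ?U"
      proof (cases "y < e")
        case True
        then show ?thesis using 3 by (auto simp: corner_def)
      next
        case False
        then have "max x y = y" using 3 by simp
        then show ?thesis using 3 False y out(2)[of x] by (auto simp: corner_def)
      qed
    qed
    then have "card ?L \<le> card ({Row x} \<union> Col ` ?E \<union> Hook ` ?U)"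
      by (intro card_mono) auto
    also have "\<dots> \<le> card {Row x} + card (Col ` ?E) + card (Hook ` ?U)"
      by (rule order_trans[OF card_Un_le add_right_mono[OF card_Un_le]])
    also have "\<dots> \<le> 1 + card ?E + card ?U"
      using card_image_le[of ?E Col] card_image_le[of ?U Hook] by simp
    also have "card ?U \<le> card ({e..<m} - ?N) + (e - x)"
      using card_Un_le[of "{e..<m} - ?N" "{m..<m + e - x}"] by simp
    also have "card ({e..<m} - ?N) = (m - e) - card ?N"
      by (subst card_Diff_subset) auto
    finally have le: "card ?L \<le> 1 + card ?E + ((m - e) - card ?N + (e - x))" by simp
    have "card ?N \<le> card {e..<m}" by (intro card_mono) auto
    then have "card ?N \<le> m - e" by simp
    moreover have "card ?E + 1 \<le> card ?N" using F 3 by (simp add: flip_system_def)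
    ultimately show ?thesis using le 3 by linarith
  qed
qed

text \<open>
  Reversing the vertex order exchanges rows and columns of the corner, so the bound for columns
  follows from the one for rows.
\<close>

primrec mirror :: "label \<Rightarrow> label" where
  "mirror (Band k) = Band k"
| "mirror (Hook k) = Hook k"
| "mirror (Row k) = Col k"
| "mirror (Col k) = Row k"

lemma flip_system_mirror:
  "flip_system m e S P Q \<Longrightarrow> flip_system m e {(y, x). (x, y) \<notin> S} Q P"
  by (simp add: flip_system_def)

lemma corner_mirror:
  assumes "flip_system m e S P Q"
  shows "corner e S P Q x y = mirror (corner e {(y, x). (x, y) \<notin> S} Q P y x)"
proof -
  have "c \<ge> e" if "z \<in> P c \<or> z \<in> Q c" for c z
    using flip_system_outside[OF assms, of c] that by force
  moreover have "z < e" if "z \<in> P c \<or> z \<in> Q c" for c z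
    using assms that by (auto simp: flip_system_def)
  ultimately have "\<not> (x \<in> P y \<and> y \<in> Q x)" by (meson leD)
  then show ?thesis by (auto simp: corner_def)
qed

lemma card_corner_col:
  assumes F: "flip_system m e S P Q" and "e \<le> m"
  shows "card ((\<lambda>x. corner e S P Q x y) ` {x. x + y < m + e}) \<le> max 1 (m - y)"
proof -
  let ?c = "corner e {(y, x). (x, y) \<notin> S} Q P y"
  have "(\<lambda>x. corner e S P Q x y) ` {x. x + y < m + e} = mirror ` ?c ` {x. y + x < m + e}"
    by (simp add: image_image corner_mirror[OF F] add.commute)
  moreover have "finite (?c ` {x. y + x < m + e})"
    by (rule finite_imageI, rule finite_subset[of _ "{..<m + e}"]) auto
  ultimately have "card ((\<lambda>x. corner e S P Q x y) ` {x. x + y < m + e})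
      \<le> card (?c ` {x. y + x < m + e})"
    by (simp add: card_image_le)
  also have "\<dots> \<le> max 1 (m - y)"
    using card_corner_row[OF flip_system_mirror[OF F] \<open>e \<le> m\<close>] .
  finally show ?thesis .
qed

section \<open>Assembling band and corner\<close>

text \<open>
  The band gives a vertex at distance \<open>a\<close> from the nearer end at most \<open>min (a + 1) m\<close> queues and the
  corner at most \<open>max 1 (m - a)\<close>. The side condition on \<open>n - 2 m\<close> is only imposed if \<open>e > 0\<close>; else
  hooks alone suffice for the corner.
\<close>

lemma local_queue_number_complete_le_Suc:
  fixes G :: "('a, 'b) pre_digraph"
  assumes G: "complete_digraph n G" and m: "m \<ge> 1" and n4: "n \<le> 4 * m"
    and sq: "n > 3 * m + 1 \<Longrightarrow> (n - 2 * m)\<^sup>2 \<le> 2 * m\<^sup>2"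
  shows "local_queue_number G \<le> m + 1"
proof -
  define e where "e = n - (3 * m + 1)"
  have "e \<le> m" using n4 by (simp add: e_def)
  have "(m + e + 1)\<^sup>2 \<le> 2 * m\<^sup>2" if "e > 0"
  proof -
    have "m + e + 1 = n - 2 * m" "n > 3 * m + 1" using that by (auto simp: e_def)
    then show ?thesis using sq by simp
  qed
  then obtain S P Q where F: "flip_system m e S P Q"
    using ex_flip_system by blast
  let ?corner = "corner e S P Q"
  define band where "band i j = min (min i (n - 1 - j)) ((2 * m - (j - i)) div 2)" for i j
  define lab where "lab i j =
    (if j - i \<le> 2 * m then Band (band i j) else ?corner i (n - 1 - j))" for i j
  have not_band: "?corner x y \<noteq> Band k" for x y k by (simp add: corner_def)
  show ?thesis
  proof (rule local_queue_number_complete_le[OF G])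
    fix i x y j assume ord: "i < x" "x < y" "y < j" "j < n"
    show "lab i j \<noteq> lab x y"
    proof (cases "j - i \<le> 2 * m")
      case True
      have "(2 * m - (j - i)) div 2 < (2 * m - (y - x)) div 2" using True ord by linarith
      moreover have "n - 1 - j < n - 1 - y" using ord by linarith
      ultimately have "band i j < band x y" using ord by (simp add: band_def min_def)
      moreover have "y - x \<le> 2 * m" using True ord by linarith
      ultimately show ?thesis using True by (simp add: lab_def)
    next
      case False
      have "n - 1 - j < n - 1 - y" using ord by linarith
      then have "?corner i (n - 1 - j) \<noteq> ?corner x (n - 1 - y)"
        using ord by (intro corner_nesting)
      with False not_band show ?thesis by (auto simp: lab_def)
    qed
  next
    fix v assume v: "v < n"
    \<comment> \<open>\<open>?R\<close> and \<open>?C\<close> are the corner labels seen by \<open>v\<close> as a left and as a right end. A left end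
      of a long edge satisfies \<open>v < n - 2 m \<le> 2 m\<close> and a right end satisfies \<open>v > 2 m\<close>, so only one
      of the two sets matters.\<close>
    let ?R = "?corner v ` {y. v + y < m + e}"
    let ?C = "(\<lambda>x. ?corner x (n - 1 - v)) ` {x. x + (n - 1 - v) < m + e}"
    have bandR: "band v j < min (v + 1) (min (n - v) m)" if "v < j" "j < n" for j
      using that m unfolding band_def by linarith
    have bandC: "band i v < min (v + 1) (min (n - v) m)" if "i < v" for i
      using that m v unfolding band_def by linarith
    let ?B = "Band ` {..<min (v + 1) (min (n - v) m)}"
    have card_B: "card ?B = min (v + 1) (min (n - v) m)"
      by (simp add: card_image inj_on_def)
    have finR: "finite ?R" by (rule finite_imageI, rule finite_subset[of _ "{..<m + e}"]) auto
    have finC: "finite ?C" by (rule finite_imageI, rule finite_subset[of _ "{..<m + e}"]) auto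
    let ?X = "if v \<le> 2 * m then ?R else ?C"
    have labR: "lab v j \<in> ?B \<union> ?X" if j: "v < j" "j < n" for j
    proof (cases "j - v \<le> 2 * m")
      case False
      then have "v + (n - 1 - j) < m + e" "v \<le> 2 * m" using j n4 by (auto simp: e_def)
      then show ?thesis using False by (auto simp: lab_def)
    qed (use bandR j in \<open>auto simp: lab_def\<close>)
    have labC: "lab i v \<in> ?B \<union> ?X" if i: "i < v" for i
    proof (cases "v - i \<le> 2 * m")
      case False
      then have "i + (n - 1 - v) < m + e" "\<not> v \<le> 2 * m" using i v by (auto simp: e_def)
      then show ?thesis using False by (auto simp: lab_def)
    qed (use bandC i in \<open>auto simp: lab_def\<close>)
    have "lab v ` {v<..<n} \<union> (\<lambda>i. lab i v) ` {..<v} \<subseteq> ?B \<union> ?X"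
      by (intro Un_least image_subsetI labR labC) simp_all
    then have "card (lab v ` {v<..<n} \<union> (\<lambda>i. lab i v) ` {..<v}) \<le> card (?B \<union> ?X)"
      using finR finC by (intro card_mono) auto
    also have "\<dots> \<le> card ?B + card ?X" by (rule card_Un_le)
    also have "\<dots> \<le> m + 1"
    proof -
      have sum_le: "b + x \<le> m + 1" if "b \<le> a + 1" "b \<le> m" "x \<le> max 1 (m - a)" for a b x :: nat
        using that by arith
      have card_B_m: "card ?B \<le> m" unfolding card_B by simp
      show ?thesis
      proof (cases "v \<le> 2 * m")
        case True
        then have "?X = ?R" by simp
        with card_corner_row[OF F \<open>e \<le> m\<close>, of v] have "card ?X \<le> max 1 (m - v)" by (simp only:)
        moreover have "card ?B \<le> v + 1" unfolding card_B by simp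
        ultimately show ?thesis using card_B_m by (intro sum_le)
      next
        case False
        then have "?X = ?C" by simp
        with card_corner_col[OF F \<open>e \<le> m\<close>, of "n - 1 - v"]
        have "card ?X \<le> max 1 (m - (n - 1 - v))" by (simp only:)
        moreover have "card ?B \<le> (n - 1 - v) + 1" using v unfolding card_B by simp
        ultimately show ?thesis using card_B_m by (intro sum_le)
      qed
    qed
    finally show "card (lab v ` {v<..<n} \<union> (\<lambda>i. lab i v) ` {..<v}) \<le> m + 1" .
  qed
qed

theorem lemma7:
  fixes G :: "('a, 'b) pre_digraph" and n :: nat
  assumes "n \<ge> 1" and "complete_digraph n G"
  shows "int (local_queue_number G) \<le> \<lceil>(1 - 1 / sqrt 2) * real n\<rceil> + 1"
proof -
  define m where "m = nat \<lceil>(1 - 1 / sqrt 2) * real n\<rceil>"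
  have "(1 - 1 / sqrt 2) * real n > 0" using assms(1) by simp
  then have m_int: "int m = \<lceil>(1 - 1 / sqrt 2) * real n\<rceil>" and m: "m \<ge> 1"
    unfolding m_def by (simp_all add: less_ceiling_iff le_nat_iff)
  have "(1 - 1 / sqrt 2) * real n \<le> real m"
    unfolding m_def by (rule real_nat_ceiling_ge)
  then have "(2 + sqrt 2) * ((1 - 1 / sqrt 2) * real n) \<le> (2 + sqrt 2) * real m"
    by (intro mult_left_mono) auto
  \<comment> \<open>\<open>2 + sqrt 2\<close> is the inverse of \<open>1 - 1 / sqrt 2\<close>.\<close>
  moreover have "(2 + sqrt 2) * (1 - 1 / sqrt 2) = 1"
    by (simp add: field_simps)
  ultimately have le: "real n \<le> (2 + sqrt 2) * real m"
    by (simp flip: mult.assoc)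
  have "sqrt 2 \<le> 2" by (rule real_le_lsqrt) auto
  then have "(2 + sqrt 2) * real m \<le> 4 * real m" by (intro mult_right_mono) auto
  with le have n4: "n \<le> 4 * m" by linarith
  have "(n - 2 * m)\<^sup>2 \<le> 2 * m\<^sup>2" if "n > 3 * m + 1"
  proof -
    have "real (n - 2 * m) \<le> sqrt 2 * real m"
      using le that by (simp add: of_nat_diff algebra_simps)
    then have "(real (n - 2 * m))\<^sup>2 \<le> (sqrt 2 * real m)\<^sup>2" by (rule power_mono) simp
    also have "\<dots> = real (2 * m\<^sup>2)" by (simp add: power_mult_distrib)
    finally show ?thesis by (metis of_nat_le_iff of_nat_power)
  qed
  then have "local_queue_number G \<le> m + 1"
    using local_queue_number_complete_le_Suc[OF assms(2) m n4] by blast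
  then show ?thesis using m_int by linarith
qed

end
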